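(* Let $a$ be an integer and $p$ an odd prime with $p\nmid a(a^4-1)$. Let $\{u_n\}_{n\geq0}$ be defined by $u_0=0$, $u_1=1$, $u_{n+1}=2u_n-(a^2+1)u_{n-1}$ for $n\geq1$. If $p\equiv1\pmod4$, then $$\frac{u_{p-1}}{p}\equiv\frac{1}{2a^2}\Big(\sum_{k=1}^{\frac{p-1}{4}}\frac{a^{4k}}{k}+(1+a)q_p(1+a)+(1-a)q_p(1-a)+q_p(a^2+1)\Big)$$ $$\equiv\frac{1}{2a}\Big(-4\sum_{k=1}^{\frac{p-1}{4}}\frac{a^{4k-1}}{4k-1}+(1+a)q_p(1+a)-(1-a)q_p(1-a)\Big)-\frac12q_p(a^2+1)\pmod p;$$ if $p\equiv3\pmod4$, then $$\frac{u_{p+1}}{p}\equiv-\frac{a^2+1}{2a^2}\Big(\sum_{k=1}^{\frac{p-3}{4}}\frac{a^{4k}}{k}+(1+a)q_p(1+a)+(1-a)q_p(1-a)+q_p(a^2+1)\Big)$$ $$\equiv\frac{a^2+1}{2a}\Big(4\sum_{k=1}^{\frac{p+1}{4}}\frac{a^{4k-3}}{4k-3}-(1+a)q_p(1+a)+(1-a)q_p(1-a)\Big)+\frac{a^2+1}{2}q_p(a^2+1)\pmod p.$$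
   Context: For an odd prime $p$ and an integer $x$ with $p\nmid x$, $q_p(x)=\frac{x^{p-1}-1}{p}$. Congruences modulo $p$ between rationals with denominators prime to $p$ are understood in the ring of $p$-integral rationals. *)

theory Defs
  imports Complex_Main "HOL-Computational_Algebra.Primes"
begin

definition p_integral :: "nat \<Rightarrow> rat \<Rightarrow> bool" where
  "p_integral p x \<longleftrightarrow> \<not> int p dvd snd (quotient_of x)"

(* Congruence modulo p in the ring of p-integral rationals; p-integrality of both sides is part
   of the relation, since one side may be given as an explicit quotient by p. *)
definition rat_cong :: "nat \<Rightarrow> rat \<Rightarrow> rat \<Rightarrow> bool" where
  "rat_cong p x y \<longleftrightarrow>
     p_integral p x \<and> p_integral p y \<and> (\<exists>z. p_integral p z \<and> x - y = of_nat p * z)"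

definition fermat_quotient :: "nat \<Rightarrow> int \<Rightarrow> rat" where
  "fermat_quotient p x = (of_int x ^ (p - 1) - 1) / of_nat p"

end

theory Submission
  imports Defs "HOL-Number_Theory.Residues"
begin

text \<open>
  Put \<open>z = 1 + a i\<close>. Then \<open>z\<^sup>n = (u\<^sub>n\<^sub>+\<^sub>1 - u\<^sub>n) + a u\<^sub>n i\<close>, and the binomial theorem gives
  \<open>z\<^sup>p = (1 + p R) + (\<plusminus> a\<^sup>p + p I) i\<close>, where \<open>R\<close> and \<open>I\<close> are the real and imaginary parts of
  the sum of \<open>(p choose k) / p * (a i)\<^sup>k\<close> over \<open>0 < k < p\<close>. Expanding \<open>(1 \<plusminus> a)\<^sup>p\<close> likewise
  expresses the Fermat quotients at \<open>1 \<plusminus> a\<close> through the same coefficients, and comparing norms,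
  \<open>|z\<^sup>p|\<^sup>2 = (a\<^sup>2 + 1)\<^sup>p\<close>, gives a linear relation modulo \<open>p\<close> between \<open>R\<close>, \<open>I\<close> and the Fermat
  quotients at \<open>a\<close> and \<open>a\<^sup>2 + 1\<close>. Eliminating \<open>I\<close> or \<open>R\<close> yields the two expressions; summing over
  \<open>1\<close>, \<open>-1\<close>, \<open>i\<close>, \<open>-i\<close> filters one residue class of \<open>k\<close> modulo 4, and
  \<open>(p choose k) / p \<equiv> (-1)\<^sup>k\<^sup>-\<^sup>1 / k\<close>.
\<close>

section \<open>The ring of p-integral rationals\<close>

text \<open>The reduced denominator divides every other denominator of the same number, so any
  single representation with denominator prime to \<open>p\<close> suffices. Closure proofs can then
  work with unreduced fractions.\<close>

lemma p_integral_iff: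
  "p_integral p x \<longleftrightarrow> (\<exists>m n. x = of_int m / of_int n \<and> \<not> int p dvd n)"
proof
  assume "p_integral p x"
  then show "\<exists>m n. x = of_int m / of_int n \<and> \<not> int p dvd n"
    unfolding p_integral_def by (metis quotient_of_div prod.collapse)
next
  assume "\<exists>m n. x = of_int m / of_int n \<and> \<not> int p dvd n"
  then obtain m n where mn: "x = of_int m / of_int n" "\<not> int p dvd n" by blast
  then have n0: "n \<noteq> 0" by auto
  obtain r s where rs: "quotient_of x = (r, s)" by (cases "quotient_of x")
  then have x: "x = of_int r / of_int s" and cop: "coprime r s" and s: "s > 0"
    by (auto intro: quotient_of_div quotient_of_coprime quotient_of_denom_pos)
  have "of_int (m * s) = (of_int (r * n) :: rat)"
    using mn(1) x n0 s by (simp add: field_simps)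
  then have "m * s = r * n" by (simp only: of_int_eq_iff)
  then have "s dvd r * n" by (metis dvd_triv_right)
  then have "s dvd n" using cop by (simp add: coprime_dvd_mult_right_iff coprime_commute)
  then show "p_integral p x"
    using mn(2) rs unfolding p_integral_def by (auto dest: dvd_trans)
qed

definition bcoeff :: "nat \<Rightarrow> nat \<Rightarrow> rat" where
  "bcoeff p k = of_nat (p choose k) / of_nat p"

context
  fixes p :: nat
  assumes p: "prime p"
begin

lemma p_integral_of_int [simp, intro]: "p_integral p (of_int m)"
proof -
  have "\<not> int p dvd 1" using p by auto
  then show ?thesis unfolding p_integral_iff by (metis div_by_1 of_int_1)
qed

lemma p_integral_of_nat [simp, intro]: "p_integral p (of_nat m)"
  using p_integral_of_int[of "int m"] by simp

lemma p_integral_1 [simp, intro]: "p_integral p 1"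
  using p_integral_of_int[of 1] by simp

lemma p_integral_0 [simp, intro]: "p_integral p 0"
  using p_integral_of_int[of 0] by simp

lemma p_integral_numeral [simp, intro]: "p_integral p (numeral m)"
  using p_integral_of_int[of "numeral m"] by simp

lemma p_integral_inverse_of_int: "\<not> int p dvd n \<Longrightarrow> p_integral p (1 / of_int n)"
  unfolding p_integral_iff by (metis of_int_1)

lemma p_integral_add [intro]:
  assumes "p_integral p x" "p_integral p y" shows "p_integral p (x + y)"
proof -
  obtain m n r s where "x = of_int m / of_int n" "\<not> int p dvd n"
    "y = of_int r / of_int s" "\<not> int p dvd s"
    using assms unfolding p_integral_iff by blast
  moreover from this have "n \<noteq> 0" "s \<noteq> 0" by auto
  moreover have "\<not> int p dvd n * s"
    using p calculation by (simp add: prime_dvd_mult_iff)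
  ultimately show ?thesis unfolding p_integral_iff
    by (intro exI[of _ "m * s + r * n"] exI[of _ "n * s"]) (simp add: field_simps)
qed

lemma p_integral_mult [intro]:
  assumes "p_integral p x" "p_integral p y" shows "p_integral p (x * y)"
proof -
  obtain m n r s where "x = of_int m / of_int n" "\<not> int p dvd n"
    "y = of_int r / of_int s" "\<not> int p dvd s"
    using assms unfolding p_integral_iff by blast
  moreover have "\<not> int p dvd n * s"
    using p calculation by (simp add: prime_dvd_mult_iff)
  ultimately show ?thesis unfolding p_integral_iff
    by (intro exI[of _ "m * r"] exI[of _ "n * s"]) simp
qed

lemma p_integral_uminus [intro]: "p_integral p x \<Longrightarrow> p_integral p (- x)"
  using p_integral_mult[OF p_integral_of_int[of "- 1"], of x] by simp

lemma p_integral_diff [intro]: "p_integral p x \<Longrightarrow> p_integral p y \<Longrightarrow> p_integral p (x - y)"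
  using p_integral_add[OF _ p_integral_uminus, of x y] by simp

lemma p_integral_power [intro]: "p_integral p x \<Longrightarrow> p_integral p (x ^ n)"
  by (induction n) auto

lemma p_integral_sum [intro]: "(\<And>k. k \<in> S \<Longrightarrow> p_integral p (f k)) \<Longrightarrow> p_integral p (sum f S)"
  by (induction S rule: infinite_finite_induct) auto

text \<open>Integrality of \<open>y\<close> is automatic from \<open>y = x - p z\<close>, so only
  the left side and the cofactor \<open>z\<close> have to be checked.\<close>

lemma rat_congI:
  assumes "p_integral p x" "p_integral p z" "x - y = of_nat p * z"
  shows "rat_cong p x y"
proof -
  have "y = x - of_nat p * z" using assms(3) by simp
  then have "p_integral p y" using assms(1,2) by auto
  then show ?thesis unfolding rat_cong_def using assms by blast
qed

lemma prime_dvd_int_power_diff: "int p dvd a ^ p - a"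
proof (cases "int p dvd a")
  case True
  then show ?thesis using p by (intro dvd_diff dvd_power_le[of _ _ 1 p, simplified])
    (auto simp: Suc_le_eq prime_gt_0_nat)
next
  case False
  \<comment> \<open>\<open>fermat_theorem\<close> speaks of naturals, so \<open>a\<close> is
    replaced by its least nonnegative residue.\<close>
  define b where "b = nat (a mod int p)"
  have pp: "p > 0" using p by (simp add: prime_gt_0_nat)
  have b: "[a = int b] (mod int p)" using pp by (simp add: b_def cong_def)
  then have "\<not> p dvd b" using False by (metis cong_dvd_iff int_dvd_int_iff)
  then have "[b ^ (p - 1) = 1] (mod p)" using p by (rule fermat_theorem[rotated])
  then have "[int b ^ (p - 1) = 1] (mod int p)" by (metis cong_int_iff of_nat_1 of_nat_power)
  then have "[a ^ (p - 1) = 1] (mod int p)" using b by (meson cong_pow cong_trans)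
  then have "[a ^ (p - 1) * a = 1 * a] (mod int p)" by (rule cong_mult) simp
  moreover have "a ^ (p - 1) * a = a ^ p" using pp by (metis power_minus_mult)
  ultimately show ?thesis by (simp add: cong_iff_dvd_diff)
qed

section \<open>The coefficients (p choose k) / p\<close>

text \<open>By Pascal's rule, neighbouring entries of row \<open>p - 1\<close> add up to an entry of
  row \<open>p\<close> divisible by \<open>p\<close>, so the signs alternate.\<close>

lemma binomial_prime_minus_one_cong:
  assumes "k < p"
  shows "[int ((p - 1) choose k) = (- 1) ^ k] (mod int p)"
  using assms
proof (induction k)
  case 0
  show ?case by simp
next
  case (Suc k)
  have "p choose Suc k = ((p - 1) choose k) + ((p - 1) choose Suc k)"
    using Suc.prems by (cases p) auto
  moreover have "p dvd p choose Suc k"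
    using p Suc.prems by (intro dvd_choose_prime) auto
  ultimately have "int p dvd int ((p - 1) choose k) + int ((p - 1) choose Suc k)"
    by (metis int_dvd_int_iff of_nat_add)
  moreover have "int p dvd int ((p - 1) choose k) - (- 1) ^ k"
    using Suc by (simp add: cong_iff_dvd_diff)
  ultimately have "int p dvd (int ((p - 1) choose k) + int ((p - 1) choose Suc k))
      - (int ((p - 1) choose k) - (- 1) ^ k)" by (rule dvd_diff)
  then show ?case by (simp add: cong_iff_dvd_diff)
qed

lemma p_integral_bcoeff: "0 < k \<Longrightarrow> k < p \<Longrightarrow> p_integral p (bcoeff p k)"
proof -
  assume k: "0 < k" "k < p"
  then have "p dvd p choose k" using p by (intro dvd_choose_prime) auto
  then obtain d where "p choose k = p * d" by blast
  then have "bcoeff p k = of_nat d" using k by (simp add: bcoeff_def)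
  then show ?thesis by simp
qed

text \<open>Divide the absorption identity \<open>k (p choose k) = p (p - 1 choose k - 1)\<close> by
  \<open>k p\<close>; the error term stays integral because \<open>k\<close> is prime to
  \<open>p\<close>.\<close>

lemma bcoeff_cong_inverse:
  assumes "0 < k" "k < p"
  shows "\<exists>z. p_integral p z \<and> bcoeff p k = (- 1) ^ (k - 1) / of_nat k + of_nat p * z"
proof -
  have "int p dvd int ((p - 1) choose (k - 1)) - (- 1) ^ (k - 1)"
    using binomial_prime_minus_one_cong[of "k - 1"] assms by (simp add: cong_iff_dvd_diff)
  then obtain d where d: "int ((p - 1) choose (k - 1)) = (- 1) ^ (k - 1) + int p * d"
    by (metis add.commute diff_add_cancel dvdE)
  have "k * (p choose k) = p * ((p - 1) choose (k - 1))"
    using assms by (metis times_binomial_minus1_eq)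
  then have "of_nat k * of_nat (p choose k) = (of_nat p * of_nat ((p - 1) choose (k - 1)) :: rat)"
    by (metis of_nat_mult)
  moreover have "of_nat ((p - 1) choose (k - 1)) = ((- 1) ^ (k - 1) + of_nat p * of_int d :: rat)"
    using arg_cong[OF d, of "of_int :: int \<Rightarrow> rat"] by simp
  ultimately have "bcoeff p k = (- 1) ^ (k - 1) / of_nat k + of_nat p * (of_int d * (1 / of_int (int k)))"
    using assms by (simp add: bcoeff_def field_simps)
  moreover have "\<not> int p dvd int k" using assms by (auto dest: dvd_imp_le)
  then have "p_integral p (of_int d * (1 / of_int (int k)))"
    by (intro p_integral_mult p_integral_inverse_of_int) auto
  ultimately show ?thesis by blast
qed

lemma sum_choose_prime_split:
  fixes f :: "nat \<Rightarrow> rat"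
  shows "(\<Sum>k\<le>p. of_nat (p choose k) * f k)
    = f 0 + f p + of_nat p * (\<Sum>k = 1..<p. bcoeff p k * f k)"
proof -
  have p1: "p > 1" using p by (simp add: prime_gt_Suc_0_nat)
  have "{..p} = insert 0 (insert p {1..<p})" using p1 by auto
  then have "(\<Sum>k\<le>p. of_nat (p choose k) * f k)
      = f 0 + f p + (\<Sum>k = 1..<p. of_nat (p choose k) * f k)"
    using p1 by simp
  also have "(\<Sum>k = 1..<p. of_nat (p choose k) * f k)
      = of_nat p * (\<Sum>k = 1..<p. bcoeff p k * f k)"
    using p1 by (simp add: sum_distrib_left bcoeff_def)
  finally show ?thesis .
qed

lemma one_plus_power_prime:
  fixes x :: rat
  shows "(1 + x) ^ p = 1 + x ^ p + of_nat p * (\<Sum>k = 1..<p. bcoeff p k * x ^ k)"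
  using sum_choose_prime_split[of "\<lambda>k. x ^ k"] binomial_ring[of x 1 p]
  by (simp add: add.commute)

text \<open>Here \<open>w\<close> is a filter, equal to \<open>e\<close> on the residue class
  enumerated by \<open>g\<close> and 0 elsewhere, and \<open>s\<close> is the constant sign on that
  class. Replacing \<open>bcoeff p k\<close> by \<open>s / k\<close> turns a filtered binomial sum
  into a sum of the kind in the theorem.\<close>

lemma sum_bcoeff_reindex:
  fixes w :: "nat \<Rightarrow> rat" and x e s :: rat and g :: "nat \<Rightarrow> nat"
  assumes x: "p_integral p x" and e: "p_integral p e"
    and inj: "inj_on g J" and sub: "g ` J \<subseteq> {1..<p}"
    and zero: "\<And>k. k \<in> {1..<p} - g ` J \<Longrightarrow> w k = 0"
    and we: "\<And>j. j \<in> J \<Longrightarrow> w (g j) = e"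
    and sign: "\<And>j. j \<in> J \<Longrightarrow> (- 1) ^ (g j - 1) = s"
  shows "\<exists>z. p_integral p z \<and>
    (\<Sum>k = 1..<p. bcoeff p k * (w k * x ^ k))
      = e * s * (\<Sum>j\<in>J. x ^ g j / of_nat (g j)) + of_nat p * z"
proof -
  have "\<forall>j\<in>J. \<exists>z. p_integral p z \<and>
      bcoeff p (g j) = s / of_nat (g j) + of_nat p * z"
  proof
    fix j assume j: "j \<in> J"
    then have "0 < g j" "g j < p" using sub by auto
    from bcoeff_cong_inverse[OF this] show "\<exists>z. p_integral p z \<and>
      bcoeff p (g j) = s / of_nat (g j) + of_nat p * z" using sign[OF j] by simp
  qed
  then obtain t where t: "\<And>j. j \<in> J \<Longrightarrow> p_integral p (t j)"
    "\<And>j. j \<in> J \<Longrightarrow> bcoeff p (g j) = s / of_nat (g j) + of_nat p * t j"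
    by metis
  have "(\<Sum>k = 1..<p. bcoeff p k * (w k * x ^ k)) = (\<Sum>k\<in>g ` J. bcoeff p k * (w k * x ^ k))"
    using sub zero by (intro sum.mono_neutral_right) auto
  also have "\<dots> = (\<Sum>j\<in>J. bcoeff p (g j) * (w (g j) * x ^ g j))"
    using inj by (simp add: sum.reindex)
  also have "\<dots> = (\<Sum>j\<in>J. e * s * (x ^ g j / of_nat (g j)) + of_nat p * (t j * (e * x ^ g j)))"
    by (intro sum.cong refl) (simp add: we t(2) algebra_simps)
  also have "\<dots> = e * s * (\<Sum>j\<in>J. x ^ g j / of_nat (g j))
      + of_nat p * (\<Sum>j\<in>J. t j * (e * x ^ g j))"
    by (simp only: sum.distrib sum_distrib_left)
  finally show ?thesis using t(1) x e
    by (intro exI[of _ "\<Sum>j\<in>J. t j * (e * x ^ g j)"] conjI p_integral_sum p_integral_mult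
      p_integral_power)
qed

end

section \<open>Powers of the imaginary unit\<close>

text \<open>The real part of \<open>i^k\<close>, integer-valued so that identities obtained over the
  complex numbers can be moved to \<open>int\<close> and \<open>rat\<close>.\<close>

definition i_re :: "nat \<Rightarrow> int" where
  "i_re k = (if k mod 4 = 0 then 1 else if k mod 4 = 2 then - 1 else 0)"

definition i_im :: "nat \<Rightarrow> int" where
  "i_im k = (if k mod 4 = 1 then 1 else if k mod 4 = 3 then - 1 else 0)"

lemma nat_mod4_cases:
  fixes k :: nat
  obtains m where "k = 4 * m" | m where "k = 4 * m + 1" | m where "k = 4 * m + 2"
    | m where "k = 4 * m + 3"
proof -
  have "k = 4 * (k div 4) \<or> k = 4 * (k div 4) + 1 \<or> k = 4 * (k div 4) + 2 \<or> k = 4 * (k div 4) + 3"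
    by presburger
  then show ?thesis using that by blast
qed

lemma i_parts:
  "i_re (4 * m) = 1" "i_im (4 * m) = 0" "i_re (4 * m + 1) = 0" "i_im (4 * m + 1) = 1"
  "i_re (4 * m + 2) = - 1" "i_im (4 * m + 2) = 0" "i_re (4 * m + 3) = 0" "i_im (4 * m + 3) = - 1"
  unfolding i_re_def i_im_def by presburger+

lemma i_power: "\<i> ^ k = Complex (of_int (i_re k)) (of_int (i_im k))"
  by (cases k rule: nat_mod4_cases)
    (simp_all only: i_parts power_add power_mult power4_eq_xxxx power3_eq_cube power2_eq_square
      power_one power_one_right, simp_all add: complex_eq_iff)

text \<open>Orthogonality of the fourth roots of unity: the left sides are the sums of
  \<open>w^(k - r)\<close> over \<open>w = 1, -1, i, -i\<close>, for \<open>r = 0, 3, 1\<close> in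
  turn.\<close>

lemma mod4_filter:
  "1 + (- 1) ^ k + 2 * of_int (i_re k) = (if k mod 4 = 0 then 4 else 0 :: rat)"
  "1 - (- 1) ^ k - 2 * of_int (i_im k) = (if k mod 4 = 3 then 4 else 0 :: rat)"
  "1 - (- 1) ^ k + 2 * of_int (i_im k) = (if k mod 4 = 1 then 4 else 0 :: rat)"
proof -
  have "even k \<longleftrightarrow> k mod 4 = 0 \<or> k mod 4 = 2" and "k mod 4 < 4" by presburger simp
  then show
    "1 + (- 1) ^ k + 2 * of_int (i_re k) = (if k mod 4 = 0 then 4 else 0 :: rat)"
    "1 - (- 1) ^ k - 2 * of_int (i_im k) = (if k mod 4 = 3 then 4 else 0 :: rat)"
    "1 - (- 1) ^ k + 2 * of_int (i_im k) = (if k mod 4 = 1 then 4 else 0 :: rat)"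
    by (auto simp: minus_one_power_iff i_re_def i_im_def)
qed

section \<open>The Lucas sequence\<close>

text \<open>The characteristic polynomial \<open>x^2 - 2 x + (a^2 + 1)\<close> has the roots
  \<open>1 + a i\<close> and \<open>1 - a i\<close>.\<close>

locale lucas_2 =
  fixes a :: int and u :: "nat \<Rightarrow> int"
  assumes u0: "u 0 = 0" and u1: "u 1 = 1"
    and u_rec: "\<And>n. n \<ge> 1 \<Longrightarrow> u (n + 1) = 2 * u n - (a\<^sup>2 + 1) * u (n - 1)"
begin

lemma u_Suc_Suc: "u (Suc (Suc n)) = 2 * u (Suc n) - (a\<^sup>2 + 1) * u n"
  using u_rec[of "Suc n"] by simp

lemma power_one_plus_a_i:
  "(1 + of_int a * \<i>) ^ n = Complex (of_int (u (Suc n) - u n)) (of_int (a * u n))"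
proof (induction n)
  case 0
  then show ?case using u0 u1 by (simp add: complex_eq_iff)
next
  case (Suc n)
  show ?case
    unfolding power_Suc Suc by (simp add: complex_eq_iff u_Suc_Suc algebra_simps power2_eq_square)
qed

text \<open>This is the squared modulus of \<open>(1 + a i)^n\<close>; by the recurrence each step
  multiplies it by \<open>a^2 + 1\<close>.\<close>

lemma u_norm: "(u (Suc n) - u n)\<^sup>2 + (a * u n)\<^sup>2 = (a\<^sup>2 + 1) ^ n"
proof (induction n)
  case 0
  then show ?case using u0 u1 by simp
next
  case (Suc n)
  have "(u (Suc (Suc n)) - u (Suc n))\<^sup>2 + (a * u (Suc n))\<^sup>2
      = (a\<^sup>2 + 1) * ((u (Suc n) - u n)\<^sup>2 + (a * u n)\<^sup>2)"
    unfolding u_Suc_Suc by (simp add: power2_eq_square algebra_simps)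
  then show ?case using Suc by simp
qed

lemma u_binomial:
  "u (Suc n) - u n = (\<Sum>k\<le>n. int (n choose k) * (i_re k * a ^ k))"
  "a * u n = (\<Sum>k\<le>n. int (n choose k) * (i_im k * a ^ k))"
proof -
  have term_eq: "(of_int a * \<i>) ^ k = Complex (of_int (i_re k * a ^ k)) (of_int (i_im k * a ^ k))" for k
  proof -
    \<comment> \<open>The factor \<open>a^k\<close> is real, so it merely scales the two parts of
      \<open>i^k\<close>.\<close>
    have "of_int a ^ k = complex_of_real (of_int a ^ k)" by simp
    then show ?thesis unfolding power_mult_distrib i_power
      by (simp add: complex_eq_iff del: of_real_power)
  qed
  have "Complex (of_int (u (Suc n) - u n)) (of_int (a * u n)) = (of_int a * \<i> + 1) ^ n"
    using power_one_plus_a_i[of n] by (simp add: add.commute)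
  also have "\<dots> = (\<Sum>k\<le>n. of_nat (n choose k) * (of_int a * \<i>) ^ k)"
    by (simp add: binomial_ring)
  finally have c: "Complex (of_int (u (Suc n) - u n)) (of_int (a * u n))
    = (\<Sum>k\<le>n. of_nat (n choose k) * Complex (of_int (i_re k * a ^ k)) (of_int (i_im k * a ^ k)))"
    by (simp only: term_eq)
  have "real_of_int (u (Suc n) - u n) = of_int (\<Sum>k\<le>n. int (n choose k) * (i_re k * a ^ k))"
    using arg_cong[OF c, of Re] by (simp add: Re_sum)
  then show "u (Suc n) - u n = (\<Sum>k\<le>n. int (n choose k) * (i_re k * a ^ k))"
    by (simp only: of_int_eq_iff)
  have "real_of_int (a * u n) = of_int (\<Sum>k\<le>n. int (n choose k) * (i_im k * a ^ k))"
    using arg_cong[OF c, of Im] by (simp add: Im_sum)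
  then show "a * u n = (\<Sum>k\<le>n. int (n choose k) * (i_im k * a ^ k))"
    by (simp only: of_int_eq_iff)
qed

end

theorem theorem5p4:
  fixes a :: int and p :: nat and u :: "nat \<Rightarrow> int"
  defines "A \<equiv> (of_int a :: rat)"
  defines "q \<equiv> fermat_quotient p"
  assumes "prime p" and "odd p"
    and "\<not> int p dvd a * (a ^ 4 - 1)"
    and "u 0 = 0" and "u 1 = 1"
    and "\<And>n. n \<ge> 1 \<Longrightarrow> u (n + 1) = 2 * u n - (a\<^sup>2 + 1) * u (n - 1)"
  shows "(p mod 4 = 1 \<longrightarrow>
      rat_cong p
        (of_int (u (p - 1)) / of_nat p)
        (1 / (2 * A\<^sup>2) *
          ((\<Sum>k = 1..(p - 1) div 4. A ^ (4 * k) / of_nat k)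
            + (1 + A) * q (1 + a) + (1 - A) * q (1 - a) + q (a\<^sup>2 + 1)))
    \<and> rat_cong p
        (1 / (2 * A\<^sup>2) *
          ((\<Sum>k = 1..(p - 1) div 4. A ^ (4 * k) / of_nat k)
            + (1 + A) * q (1 + a) + (1 - A) * q (1 - a) + q (a\<^sup>2 + 1)))
        (1 / (2 * A) *
          (- 4 * (\<Sum>k = 1..(p - 1) div 4. A ^ (4 * k - 1) / of_nat (4 * k - 1))
            + (1 + A) * q (1 + a) - (1 - A) * q (1 - a))
          - 1 / 2 * q (a\<^sup>2 + 1)))
  \<and> (p mod 4 = 3 \<longrightarrow>
      rat_cong p
        (of_int (u (p + 1)) / of_nat p)
        (- ((A\<^sup>2 + 1) / (2 * A\<^sup>2)) *
          ((\<Sum>k = 1..(p - 3) div 4. A ^ (4 * k) / of_nat k)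
            + (1 + A) * q (1 + a) + (1 - A) * q (1 - a) + q (a\<^sup>2 + 1)))
    \<and> rat_cong p
        (- ((A\<^sup>2 + 1) / (2 * A\<^sup>2)) *
          ((\<Sum>k = 1..(p - 3) div 4. A ^ (4 * k) / of_nat k)
            + (1 + A) * q (1 + a) + (1 - A) * q (1 - a) + q (a\<^sup>2 + 1)))
        ((A\<^sup>2 + 1) / (2 * A) *
          (4 * (\<Sum>k = 1..(p + 1) div 4. A ^ (4 * k - 3) / of_nat (4 * k - 3))
            - (1 + A) * q (1 + a) + (1 - A) * q (1 - a))
          + (A\<^sup>2 + 1) / 2 * q (a\<^sup>2 + 1)))"
proof -
  interpret lucas_2 a u using assms(6-8) by unfold_locales
  note p = \<open>prime p\<close>
  have p1: "p > 1" using p by (rule prime_gt_1_nat)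
  define P :: rat where "P = of_nat p"
  have P0: "P \<noteq> 0" using p1 by (simp add: P_def)
  \<comment> \<open>The factorisation makes \<open>a\<close> and \<open>a^2 + 1\<close> units modulo
    \<open>p\<close>, so that \<open>A\<close> and \<open>A^2 + 1\<close> may occur in
    denominators.\<close>
  have "a * (a ^ 4 - 1) = a * (a\<^sup>2 + 1) * (a\<^sup>2 - 1)"
    by (simp add: algebra_simps power2_eq_square power4_eq_xxxx)
  then have ndvd: "\<not> int p dvd a" "\<not> int p dvd a\<^sup>2 + 1"
    using assms(5) by (metis dvd_mult2 dvd_mult)+
  have ndvd2: "\<not> int p dvd 2"
  proof
    assume "int p dvd 2"
    then have "p dvd 2" by (metis int_dvd_int_iff of_nat_numeral)
    then have "p = 2" using p by (metis primes_dvd_imp_eq two_is_prime_nat)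
    with \<open>odd p\<close> show False by simp
  qed
  have A: "p_integral p A" by (simp add: A_def p)
  have invA: "p_integral p (1 / A)"
    using p_integral_inverse_of_int[OF p ndvd(1)] by (simp add: A_def)
  have invN: "p_integral p (1 / (A\<^sup>2 + 1))"
    using p_integral_inverse_of_int[OF p ndvd(2)] by (simp add: A_def)
  have half: "p_integral p (1 / 2)"
    using p_integral_inverse_of_int[OF p ndvd2] by simp
  have A0: "A \<noteq> 0" using ndvd(1) by (auto simp: A_def)
  have "a\<^sup>2 + 1 \<noteq> 0" using ndvd(2) by auto
  then have N0: "A\<^sup>2 + 1 \<noteq> 0"
    unfolding A_def by (metis of_int_1 of_int_add of_int_eq_0_iff of_int_power)

  have div_eq: "d * x = y \<Longrightarrow> d \<noteq> 0 \<Longrightarrow> x = y / d" for d x y :: rat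
    by auto

  \<comment> \<open>\<open>T\<close> is \<open>A * q a\<close>. \<open>L x\<close> is
    \<open>((1 + x)^p - 1 - x^p) / p\<close>, and \<open>R\<close>, \<open>I\<close> are the parts
    of the same polynomial at \<open>A i\<close>. The sign \<open>e\<close> satisfies
    \<open>i^p = e i\<close>.\<close>
  define T where "T = (A ^ p - A) / P"
  define L where "L = (\<lambda>x. \<Sum>k = 1..<p. bcoeff p k * x ^ k)"
  define R where "R = (\<Sum>k = 1..<p. bcoeff p k * (of_int (i_re k) * A ^ k))"
  define I where "I = (\<Sum>k = 1..<p. bcoeff p k * (of_int (i_im k) * A ^ k))"
  define e :: rat where "e = of_int (i_im p)"

  have T: "p_integral p T"
  proof -
    obtain d where "a ^ p - a = int p * d" using prime_dvd_int_power_diff[OF p] by blast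
    from arg_cong[OF this, of "of_int :: int \<Rightarrow> rat"] have "T = of_int d"
      using P0 by (simp add: T_def A_def P_def)
    then show ?thesis by (simp add: p)
  qed
  have R: "p_integral p R" and I: "p_integral p I"
    unfolding R_def I_def
    using p_integral_mult[OF p] p_integral_power[OF p] p_integral_bcoeff[OF p] A
    by (auto simp: p intro!: p_integral_sum)
  have e: "p_integral p e" by (simp add: e_def p)

  have "p mod 4 = 1 \<or> p mod 4 = 3" using \<open>odd p\<close> by presburger
  then have re_p: "i_re p = 0" and im_p: "(i_im p)\<^sup>2 = 1"
    by (auto simp: i_re_def i_im_def)
  have e2: "e\<^sup>2 = 1" using im_p unfolding e_def by (metis of_int_1 of_int_power)

  \<comment> \<open>Exact formulas for the Fermat quotients and for \<open>u\<close> near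
    \<open>p\<close>\<close>
  have Ap: "A ^ p = A + P * T" using P0 by (simp add: T_def)
  \<comment> \<open>The factor \<open>x\<close> raises the exponent from \<open>p - 1\<close> to
    \<open>p\<close>, where the binomial expansion applies.\<close>
  have x_times_q: "of_int x * q x = (of_int x ^ p - of_int x) / P" for x
  proof -
    have "of_int x * (of_int x ^ (p - 1)) = (of_int x ^ p :: rat)"
      using p1 by (cases p) auto
    then show ?thesis by (simp add: q_def fermat_quotient_def P_def algebra_simps diff_divide_distrib)
  qed
  have q_plus: "(1 + A) * q (1 + a) = T + L A"
    using x_times_q[of "1 + a"] one_plus_power_prime[OF p, of A] P0
    by (simp add: A_def T_def L_def P_def field_simps)
  \<comment> \<open>Since \<open>p\<close> is odd, \<open>(- A)^p = - A^p\<close>, which flips the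
    sign of \<open>T\<close>.\<close>
  have q_minus: "(1 - A) * q (1 - a) = - T + L (- A)"
    using x_times_q[of "1 - a"] one_plus_power_prime[OF p, of "- A"] P0 \<open>odd p\<close>
    by (simp add: A_def T_def L_def P_def field_simps)
  have re_eq: "of_int (u (Suc p) - u p) = 1 + P * R"
  proof -
    have "of_int (u (Suc p) - u p) = (\<Sum>k\<le>p. of_nat (p choose k) * (of_int (i_re k) * A ^ k))"
      unfolding u_binomial by (simp add: A_def)
    then show ?thesis
      unfolding sum_choose_prime_split[OF p] using re_p by (simp add: i_re_def R_def P_def)
  qed
  \<comment> \<open>The end term \<open>k = 0\<close> is real and the end term \<open>k = p\<close>
    is \<open>e A^p\<close> times \<open>i\<close>.\<close>
  have im_eq: "A * of_int (u p) = e * (A + P * T) + P * I"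
  proof -
    have "A * of_int (u p) = of_int (a * u p)" by (simp add: A_def)
    also have "\<dots> = (\<Sum>k\<le>p. of_nat (p choose k) * (of_int (i_im k) * A ^ k))"
      unfolding u_binomial by (simp add: A_def)
    finally show ?thesis
      unfolding sum_choose_prime_split[OF p] by (simp add: i_im_def I_def P_def e_def Ap)
  qed

  \<comment> \<open>Comparison of norms\<close>
  define z2 where "z2 = R\<^sup>2 + I\<^sup>2 + 2 * e * T * I + T\<^sup>2"
  have z2: "p_integral p z2"
    unfolding z2_def
    by (intro p_integral_add p_integral_mult p_integral_power R I T e p_integral_numeral p)
  \<comment> \<open>An exact identity: \<open>z2\<close> collects the coefficient of
    \<open>P^2\<close> when the squared modulus is expanded.\<close>
  have q_norm: "(A\<^sup>2 + 1) * q (a\<^sup>2 + 1) = 2 * R + 2 * e * A * I + 2 * A * T + P * z2"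
  proof -
    have "(A\<^sup>2 + 1) ^ p = of_int ((u (Suc p) - u p)\<^sup>2 + (a * u p)\<^sup>2)"
      unfolding u_norm by (simp add: A_def)
    also have "\<dots> = (of_int (u (Suc p) - u p))\<^sup>2 + (A * of_int (u p))\<^sup>2"
      by (simp add: A_def)
    also have "\<dots> = (1 + P * R)\<^sup>2 + (e * (A + P * T) + P * I)\<^sup>2"
      unfolding re_eq im_eq ..
    also have "\<dots> = A\<^sup>2 + 1 + P * (2 * R + 2 * e * A * I + 2 * A * T + P * z2)"
      \<comment> \<open>qualified because HOL-Algebra declares a weaker method of the same name\<close>
      unfolding z2_def using e2 by Groebner_Basis.algebra
    finally have "(A\<^sup>2 + 1) ^ p - (A\<^sup>2 + 1)
      = P * (2 * R + 2 * e * A * I + 2 * A * T + P * z2)" by simp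
    moreover have "(A\<^sup>2 + 1) * q (a\<^sup>2 + 1) = ((A\<^sup>2 + 1) ^ p - (A\<^sup>2 + 1)) / P"
      using x_times_q[of "a\<^sup>2 + 1"] by (simp add: A_def)
    ultimately show ?thesis using P0 by simp
  qed

  \<comment> \<open>Filtering residue classes modulo 4\<close>
  have L_even: "L A + L (- A) + 2 * R
      = (\<Sum>k = 1..<p. bcoeff p k * ((1 + (- 1) ^ k + 2 * of_int (i_re k)) * A ^ k))"
    unfolding L_def R_def sum_distrib_left sum.distrib[symmetric]
    by (intro sum.cong refl) (simp add: power_minus[of A] algebra_simps)
  \<comment> \<open>\<open>d = 1\<close> keeps the class of 3 and \<open>d = - 1\<close> the class
    of 1; below, \<open>d\<close> is always taken equal to \<open>e\<close>.\<close>
  have L_odd: "L A - L (- A) - 2 * d * I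
      = (\<Sum>k = 1..<p. bcoeff p k * ((1 - (- 1) ^ k - 2 * d * of_int (i_im k)) * A ^ k))" for d
    unfolding L_def I_def sum_distrib_left sum_subtractf[symmetric]
    by (intro sum.cong refl) (simp add: power_minus[of A] algebra_simps)

  \<comment> \<open>The bounds say that \<open>m\<close> counts the positive multiples of 4 below
    \<open>p\<close>. The filter weight 4 cancels against \<open>1 / (4 j)\<close>.\<close>
  have even_part: "\<exists>z. p_integral p z \<and>
      (\<Sum>k = 1..m. A ^ (4 * k) / of_nat k) + L A + L (- A) = - 2 * R + P * z"
    if m: "4 * m < p" "p \<le> 4 * m + 4" for m
  proof -
    have "\<exists>z. p_integral p z \<and>
      (\<Sum>k = 1..<p. bcoeff p k * ((1 + (- 1) ^ k + 2 * of_int (i_re k)) * A ^ k))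
      = 4 * (- 1) * (\<Sum>j\<in>{1..m}. A ^ (4 * j) / of_nat (4 * j)) + of_nat p * z"
    proof (rule sum_bcoeff_reindex[OF p A p_integral_numeral[OF p]])
      fix k assume "k \<in> {1..<p} - (\<lambda>j. 4 * j) ` {1..m}"
      \<comment> \<open>Outside \<open>{1..m}\<close>, \<open>j = 0\<close> gives
        \<open>k = 0\<close> and \<open>j > m\<close> gives \<open>k\<close> at least
        \<open>p\<close>, both out of range.\<close>
      then have "k \<noteq> 4 * j" for j using m by (cases "j \<in> {1..m}") auto
      then have "k mod 4 \<noteq> 0" by (metis add_0_right mult_div_mod_eq)
      then show "1 + (- 1) ^ k + 2 * of_int (i_re k) = (0 :: rat)"
        unfolding mod4_filter by simp
    next
      fix j assume "j \<in> {1..m}"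
      then show "(- 1) ^ (4 * j - 1) = (- 1 :: rat)" by (cases j) (auto simp: power_add power_mult)
    qed (use m in \<open>auto simp: i_re_def inj_on_def\<close>)
    then obtain z where z: "p_integral p z"
      "L A + L (- A) + 2 * R = 4 * (- 1) * (\<Sum>j = 1..m. A ^ (4 * j) / of_nat (4 * j)) + P * z"
      unfolding L_even P_def by blast
    have "4 * (- 1) * (\<Sum>j = 1..m. A ^ (4 * j) / of_nat (4 * j)) = - (\<Sum>k = 1..m. A ^ (4 * k) / of_nat k)"
      unfolding sum_distrib_left sum_negf[symmetric] by (intro sum.cong refl) simp
    with z show ?thesis by (intro exI[of _ z]) (simp add: algebra_simps)
  qed

  show ?thesis
  proof (intro conjI impI)

    \<comment> \<open>The case of \<open>p\<close> congruent to 1 modulo 4\<close>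
    assume "p mod 4 = 1"
    then obtain m where m: "p = 4 * m + 1" by (metis mult_div_mod_eq)
    then have pm: "(p - 1) div 4 = m" by simp
    have e1: "e = 1" by (simp add: e_def m i_im_def)
    obtain z1 where z1: "p_integral p z1"
      "(\<Sum>k = 1..(p - 1) div 4. A ^ (4 * k) / of_nat k) + L A + L (- A) = - 2 * R + P * z1"
      using even_part[of m] m unfolding pm by auto
    have "\<exists>z. p_integral p z \<and>
      (\<Sum>k = 1..<p. bcoeff p k * ((1 - (- 1) ^ k - 2 * 1 * of_int (i_im k)) * A ^ k))
      = 4 * 1 * (\<Sum>j\<in>{1..m}. A ^ (4 * j - 1) / of_nat (4 * j - 1)) + of_nat p * z"
    proof (rule sum_bcoeff_reindex[OF p A p_integral_numeral[OF p]])
      fix k assume k: "k \<in> {1..<p} - (\<lambda>j. 4 * j - 1) ` {1..m}"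
      have "k \<noteq> 4 * j + 3" for j
      proof
        assume "k = 4 * j + 3"
        \<comment> \<open>The index shifts by one because the sum writes the class of 3 as
          \<open>4 j - 1\<close> with \<open>j\<close> starting at 1.\<close>
        then have "k = 4 * Suc j - 1" "Suc j \<in> {1..m}" using k m by auto
        then show False using k by blast
      qed
      then have "k mod 4 \<noteq> 3" by (metis mult_div_mod_eq)
      then show "1 - (- 1) ^ k - 2 * 1 * of_int (i_im k) = (0 :: rat)"
        using mod4_filter(2)[of k] by simp
    next
      fix j assume "j \<in> {1..m}"
      then obtain i where "4 * j - 1 = 4 * i + 3" by (cases j) auto
      then show "(- 1) ^ (4 * j - 1 - 1) = (1 :: rat)"
        and "1 - (- 1) ^ (4 * j - 1) - 2 * 1 * of_int (i_im (4 * j - 1)) = (4 :: rat)"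
        using mod4_filter(2)[of "4 * j - 1"] by (simp_all add: power_mult)
    qed (use m in \<open>auto simp: inj_on_def\<close>)
    then obtain z3 where z3: "p_integral p z3"
      "- 4 * (\<Sum>k = 1..(p - 1) div 4. A ^ (4 * k - 1) / of_nat (4 * k - 1)) + L A - L (- A)
        = 2 * I + P * z3"
      unfolding L_odd[symmetric] pm P_def[symmetric] by (auto simp: algebra_simps)
    let ?S = "\<Sum>k = 1..(p - 1) div 4. A ^ (4 * k) / of_nat k"
    let ?S' = "\<Sum>k = 1..(p - 1) div 4. A ^ (4 * k - 1) / of_nat (4 * k - 1)"
    let ?X = "of_int (u (p - 1)) / of_nat p :: rat"
    define X where "X = ?X"
    let ?Y = "1 / (2 * A\<^sup>2) *
      (?S + (1 + A) * q (1 + a) + (1 - A) * q (1 - a) + q (a\<^sup>2 + 1))"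
    define Y where "Y = ?Y"
    let ?Z = "1 / (2 * A) *
      (- 4 * ?S' + (1 + A) * q (1 + a) - (1 - A) * q (1 - a)) - 1 / 2 * q (a\<^sup>2 + 1)"
    define Z where "Z = ?Z"
    \<comment> \<open>The recurrence at \<open>p\<close> eliminates \<open>u (p + 1)\<close>; since
      \<open>e = 1\<close> the terms \<open>A\<close> cancel and a multiple of \<open>P\<close> is
      left.\<close>
    have X: "A * (A\<^sup>2 + 1) * X = T + I - A * R"
    proof -
      have "of_int (u (Suc p)) = 2 * of_int (u p) - (A\<^sup>2 + 1) * of_int (u (p - 1))"
        using u_rec[of p] p1 by (simp add: A_def)
      then have "A * (A\<^sup>2 + 1) * of_int (u (p - 1))
          = A * of_int (u p) - A * of_int (u (Suc p) - u p)"
        unfolding of_int_diff by Groebner_Basis.algebra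
      also have "\<dots> = P * (T + I - A * R)"
        unfolding re_eq im_eq e1 by (simp add: algebra_simps)
      finally show ?thesis using P0 by (simp add: X_def P_def field_simps)
    qed
    have Y: "2 * A\<^sup>2 * Y = - 2 * R + P * z1 + q (a\<^sup>2 + 1)"
      unfolding Y_def q_plus q_minus using z1(2) A0 by simp
    have Z: "2 * A * Z = 2 * I + P * z3 + 2 * T - A * q (a\<^sup>2 + 1)"
      unfolding Z_def q_plus q_minus using z3(2) A0 by (simp add: algebra_simps)
    have Xint: "p_integral p X"
    proof -
      have "X = (T + I - A * R) * (1 / A) * (1 / (A\<^sup>2 + 1))"
        using A0 N0 by (simp add: X[symmetric])
      also have "p_integral p \<dots>"
        by (intro p_integral_mult p_integral_add p_integral_diff p T R I A invA invN)
      finally show ?thesis .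
    qed
    \<comment> \<open>After clearing denominators, \<open>q_norm\<close> with \<open>e = 1\<close>
      cancels all main terms, leaving the errors \<open>z1\<close> and \<open>z2\<close>.
      \<open>YZ\<close> works the same way.\<close>
    have XY: "X - Y = P * (- (z1 + z2 * (1 / (A\<^sup>2 + 1))) * (1 / A)\<^sup>2 * (1 / 2))"
    proof -
      have "2 * A\<^sup>2 * (A\<^sup>2 + 1) * (X - Y) = - P * (z1 * (A\<^sup>2 + 1) + z2)"
        using X Y q_norm unfolding e1 by Groebner_Basis.algebra
      then have "X - Y = - P * (z1 * (A\<^sup>2 + 1) + z2) / (2 * A\<^sup>2 * (A\<^sup>2 + 1))"
        by (rule div_eq) (use A0 N0 in simp)
      also have "\<dots> = P * (- (z1 + z2 * (1 / (A\<^sup>2 + 1))) * (1 / A)\<^sup>2 * (1 / 2))"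
        using A0 N0 by (simp add: divide_simps)
      finally show ?thesis .
    qed
    have YZ: "Y - Z = P * ((z2 + z1) * (1 / A)\<^sup>2 * (1 / 2) - z3 * (1 / A) * (1 / 2))"
    proof -
      have "2 * A\<^sup>2 * (Y - Z) = P * (z2 + z1 - A * z3)"
        using Y Z q_norm unfolding e1 by Groebner_Basis.algebra
      then show ?thesis
        by (rule div_eq[THEN trans]) (use A0 in \<open>simp_all add: field_simps power2_eq_square\<close>)
    qed
    have XY_cong: "rat_cong p X Y"
      by (rule rat_congI[OF p Xint _ XY[unfolded P_def]])
        (intro p_integral_mult p_integral_add p_integral_uminus p_integral_power p z1 z2 invA invN half)
    \<comment> \<open>Integrality of \<open>Y\<close> is read off from
      \<open>XY_cong\<close>.\<close>
    have YZ_cong: "rat_cong p Y Z"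
      by (rule rat_congI[OF p _ _ YZ[unfolded P_def]], use XY_cong in \<open>simp add: rat_cong_def\<close>)
        (intro p_integral_mult p_integral_add p_integral_diff p_integral_power p z1 z2 z3 invA half)
    show "rat_cong p ?X ?Y" using XY_cong by (simp only: X_def Y_def)
    show "rat_cong p ?Y ?Z" using YZ_cong by (simp only: Y_def Z_def)
  next

    \<comment> \<open>The case of \<open>p\<close> congruent to 3 modulo 4\<close>
    assume "p mod 4 = 3"
    then obtain m where m: "p = 4 * m + 3" by (metis mult_div_mod_eq)
    then have pm: "(p - 3) div 4 = m" "(p + 1) div 4 = Suc m" by simp_all
    have e1: "e = - 1" by (simp add: e_def m i_im_def)
    obtain z1 where z1: "p_integral p z1"
      "(\<Sum>k = 1..(p - 3) div 4. A ^ (4 * k) / of_nat k) + L A + L (- A) = - 2 * R + P * z1"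
      using even_part[of m] m unfolding pm by auto
    \<comment> \<open>With \<open>d = - 1\<close> the surviving indices are 1, 5, ...,
      \<open>4 m + 1 = p - 2\<close>, which makes \<open>m + 1\<close> terms.\<close>
    have "\<exists>z. p_integral p z \<and>
      (\<Sum>k = 1..<p. bcoeff p k * ((1 - (- 1) ^ k - 2 * (- 1) * of_int (i_im k)) * A ^ k))
      = 4 * 1 * (\<Sum>j\<in>{1..Suc m}. A ^ (4 * j - 3) / of_nat (4 * j - 3)) + of_nat p * z"
    proof (rule sum_bcoeff_reindex[OF p A p_integral_numeral[OF p]])
      fix k assume k: "k \<in> {1..<p} - (\<lambda>j. 4 * j - 3) ` {1..Suc m}"
      have "k \<noteq> 4 * j + 1" for j
      proof
        assume "k = 4 * j + 1"
        then have "k = 4 * Suc j - 3" "Suc j \<in> {1..Suc m}" using k m by auto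
        then show False using k by blast
      qed
      then have "k mod 4 \<noteq> 1" by (metis mult_div_mod_eq)
      then show "1 - (- 1) ^ k - 2 * (- 1) * of_int (i_im k) = (0 :: rat)"
        using mod4_filter(3)[of k] by simp
    next
      fix j assume "j \<in> {1..Suc m}"
      then obtain i where "4 * j - 3 = 4 * i + 1" by (cases j) auto
      then show "(- 1) ^ (4 * j - 3 - 1) = (1 :: rat)"
        and "1 - (- 1) ^ (4 * j - 3) - 2 * (- 1) * of_int (i_im (4 * j - 3)) = (4 :: rat)"
        using mod4_filter(3)[of "4 * j - 3"] by (simp_all add: power_mult)
    qed (use m in \<open>auto simp: inj_on_def\<close>)
    then obtain z where z: "p_integral p z"
      "L A - L (- A) + 2 * I
        = 4 * (\<Sum>k = 1..(p + 1) div 4. A ^ (4 * k - 3) / of_nat (4 * k - 3)) + P * z"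
      unfolding L_odd[symmetric] pm P_def[symmetric] by (auto simp: algebra_simps)
    let ?S = "\<Sum>k = 1..(p - 3) div 4. A ^ (4 * k) / of_nat k"
    let ?S' = "\<Sum>k = 1..(p + 1) div 4. A ^ (4 * k - 3) / of_nat (4 * k - 3)"
    let ?X = "of_int (u (p + 1)) / of_nat p :: rat"
    define X where "X = ?X"
    let ?Y = "- ((A\<^sup>2 + 1) / (2 * A\<^sup>2)) *
      (?S + (1 + A) * q (1 + a) + (1 - A) * q (1 - a) + q (a\<^sup>2 + 1))"
    define Y where "Y = ?Y"
    let ?Z = "(A\<^sup>2 + 1) / (2 * A) *
      (4 * ?S' - (1 + A) * q (1 + a) + (1 - A) * q (1 - a)) + (A\<^sup>2 + 1) / 2 * q (a\<^sup>2 + 1)"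
    define Z where "Z = ?Z"
    \<comment> \<open>Now \<open>e = - 1\<close>, so the \<open>- A\<close> from
      \<open>A * u p\<close> cancels the \<open>A\<close> from the real part, again leaving a
      multiple of \<open>P\<close>.\<close>
    have X: "A * X = - T + I + A * R"
    proof -
      have "A * of_int (u (p + 1)) = A * of_int (u p) + A * of_int (u (Suc p) - u p)"
        by (simp add: algebra_simps)
      also have "\<dots> = P * (- T + I + A * R)"
        unfolding re_eq im_eq e1 by (simp add: algebra_simps)
      finally show ?thesis using P0 by (simp add: X_def P_def field_simps)
    qed
    have Y: "2 * A\<^sup>2 * Y = - ((A\<^sup>2 + 1) * (- 2 * R + P * z1 + q (a\<^sup>2 + 1)))"
    proof -
      have "2 * A\<^sup>2 * Y = - ((A\<^sup>2 + 1) * (?S + (T + L A) + (- T + L (- A)) + q (a\<^sup>2 + 1)))"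
        unfolding Y_def q_plus q_minus using A0 by simp
      also have "?S + (T + L A) + (- T + L (- A)) = - 2 * R + P * z1"
        using z1(2) by simp
      finally show ?thesis .
    qed
    have Z: "2 * A * Z = (A\<^sup>2 + 1) * (2 * I - P * z - 2 * T + A * q (a\<^sup>2 + 1))"
    proof -
      have "2 * A * Z = (A\<^sup>2 + 1) * (4 * ?S' - (T + L A) + (- T + L (- A)) + A * q (a\<^sup>2 + 1))"
        unfolding Z_def q_plus q_minus using A0 by (simp add: field_simps)
      also have "4 * ?S' - (T + L A) + (- T + L (- A)) = 2 * I - P * z - 2 * T"
        using z(2) by simp
      finally show ?thesis .
    qed
    have Xint: "p_integral p X"
    proof -
      have "X = (- T + I + A * R) * (1 / A)"
        unfolding X[symmetric] using A0 by simp
      also have "p_integral p \<dots>"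
        by (intro p_integral_mult p_integral_add p_integral_uminus p T R I A invA)
      finally show ?thesis .
    qed
    have XY: "X - Y = P * ((z1 * (A\<^sup>2 + 1) + z2) * (1 / A)\<^sup>2 * (1 / 2))"
    proof -
      have "2 * A\<^sup>2 * (X - Y) = P * (z1 * (A\<^sup>2 + 1) + z2)"
        using X Y q_norm unfolding e1 by Groebner_Basis.algebra
      then show ?thesis
        by (rule div_eq[THEN trans]) (use A0 in \<open>simp_all add: field_simps\<close>)
    qed
    have YZ: "Y - Z = P * ((A\<^sup>2 + 1) * (z * (1 / A) - (z1 + z2) * (1 / A)\<^sup>2) * (1 / 2))"
    proof -
      have "2 * A\<^sup>2 * (Y - Z) = P * (A\<^sup>2 + 1) * (z * A - z1 - z2)"
        using Y Z q_norm unfolding e1 by Groebner_Basis.algebra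
      then show ?thesis
        by (rule div_eq[THEN trans]) (use A0 in \<open>simp_all add: field_simps power2_eq_square\<close>)
    qed
    have XY_cong: "rat_cong p X Y"
      by (rule rat_congI[OF p Xint _ XY[unfolded P_def]])
        (intro p_integral_mult p_integral_add p_integral_power p_integral_1 p z1 z2 A invA half)
    have YZ_cong: "rat_cong p Y Z"
      by (rule rat_congI[OF p _ _ YZ[unfolded P_def]], use XY_cong in \<open>simp add: rat_cong_def\<close>)
        (intro p_integral_mult p_integral_add p_integral_diff p_integral_power p_integral_1 p
          z z1 z2 A invA half)
    show "rat_cong p ?X ?Y" using XY_cong by (simp only: X_def Y_def)
    show "rat_cong p ?Y ?Z" using YZ_cong by (simp only: Y_def Z_def)
  qed
qed

end
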